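(* Let $a,t\in\mathbb{C}$ and let $F_{t,a}(z)=e^{-tz^a}$ on $\Omega$, with $n$-th derivative written as $F^{(n)}_{t,a}(z)=P_{n,t,a}(z)\,e^{-tz^a}$. Then for every integer $n\ge 1$, $$P_{n,t,a}(z)=\sum_{j=1}^{n}(-1)^{j}\,b_{j,n;a}\,t^j z^{ja-n},\qquad z\in\Omega.$$ Consequently, for all $1\le j\le n$, $$b_{j,n;a}=B_{n,j}\bigl((a)_1,(a)_2,\dots,(a)_{n-j+1}\bigr).$$
   Context: $\Omega\subset\mathbb{C}\setminus\{0\}$ is a simply connected domain, and complex powers are $z^{c}=e^{c\log z}$ for a fixed holomorphic branch of the logarithm on $\Omega$. The falling factorial is $(z)_n=z(z-1)\cdots(z-n+1)$ for $n\ge1$. The triangular array $(b_{j,n;a})_{n\ge 1,\,1\le j\le n}$ is defined by $b_{1,n;a}=(a)_n$, $b_{n,n;a}=a^n$ for $n\ge 1$, and $b_{j,n+1;a}=(aj-n)b_{j,n;a}+a\,b_{j-1,n;a}$ for $2\le j\le n$. The partial Bell polynomials are $$B_{n,k}(x_1,\dots,x_{n-k+1})=\sum\frac{n!}{j_1!\cdots j_{n-k+1}!}\prod_{m=1}^{n-k+1}\left(\frac{x_m}{m!}\right)^{j_m},$$ the sum being over all nonnegative integers $j_1,\dots,j_{n-k+1}$ with $\sum_{m=1}^{n-k+1} j_m=k$ and $\sum_{m=1}^{n-k+1} m j_m=n$. *)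

theory Defs
  imports "HOL-Analysis.Analysis"
begin

definition log_branch_on :: "complex set \<Rightarrow> (complex \<Rightarrow> complex) \<Rightarrow> bool" where
  "log_branch_on \<Omega> L \<longleftrightarrow> L holomorphic_on \<Omega> \<and> (\<forall>z\<in>\<Omega>. exp (L z) = z)"

text \<open>The library's \<open>powr\<close> uses the principal logarithm; here powers are taken
  with respect to a given branch \<open>L\<close>.\<close>

definition branch_powr :: "(complex \<Rightarrow> complex) \<Rightarrow> complex \<Rightarrow> complex \<Rightarrow> complex" where
  "branch_powr L z c = exp (c * L z)"

definition exp_powr :: "(complex \<Rightarrow> complex) \<Rightarrow> complex \<Rightarrow> complex \<Rightarrow> complex \<Rightarrow> complex" where
  "exp_powr L t a z = exp (- t * branch_powr L z a)"

definition falling_fact :: "complex \<Rightarrow> nat \<Rightarrow> complex" where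
  "falling_fact z n = (\<Prod>i<n. z - of_nat i)"

text \<open>\<open>b_array a j n\<close> is $b_{j,n;a}$; it is set to 0 outside the triangle \<open>1 \<le> j \<le> n\<close>.
  The defining relations are recovered in the lemmas below.\<close>

fun b_array :: "complex \<Rightarrow> nat \<Rightarrow> nat \<Rightarrow> complex" where
  "b_array a j 0 = 0"
| "b_array a j (Suc n) =
     (if j = 0 \<or> Suc n < j then 0
      else if j = 1 then falling_fact a (Suc n)
      else if j = Suc n then a ^ Suc n
      else (a * of_nat j - of_nat n) * b_array a j n + a * b_array a (j - 1) n)"

lemma b_array_first: "1 \<le> n \<Longrightarrow> b_array a 1 n = falling_fact a n"
  by (cases n) auto

lemma b_array_diag: "1 \<le> n \<Longrightarrow> b_array a n n = a ^ n"
  by (cases n) (auto simp: falling_fact_def)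

lemma b_array_rec:
  "2 \<le> j \<Longrightarrow> j \<le> n \<Longrightarrow>
    b_array a j (n + 1) = (a * of_nat j - of_nat n) * b_array a j n + a * b_array a (j - 1) n"
  by auto

text \<open>Exponent tuples $(j_1,\dots,j_{n-k+1})$, as functions that are \<open>undefined\<close> off the
  index set so that each tuple is represented exactly once.\<close>

definition bell_indices :: "nat \<Rightarrow> nat \<Rightarrow> (nat \<Rightarrow> nat) set" where
  "bell_indices n k =
     {e \<in> {1..n - k + 1} \<rightarrow>\<^sub>E UNIV.
        (\<Sum>m = 1..n - k + 1. e m) = k \<and> (\<Sum>m = 1..n - k + 1. m * e m) = n}"

text \<open>Finiteness guarantees that the sum below is not degenerate.\<close>

lemma finite_bell_indices: "finite (bell_indices n k)"
proof (rule finite_subset)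
  show "bell_indices n k \<subseteq> {1..n - k + 1} \<rightarrow>\<^sub>E {..k}"
  proof
    fix e assume e: "e \<in> bell_indices n k"
    have "e m \<le> k" if "m \<in> {1..n - k + 1}" for m
    proof -
      have "e m \<le> (\<Sum>m = 1..n - k + 1. e m)"
        using that by (intro member_le_sum) auto
      with e show ?thesis by (simp add: bell_indices_def)
    qed
    with e show "e \<in> {1..n - k + 1} \<rightarrow>\<^sub>E {..k}"
      by (auto simp: bell_indices_def PiE_iff)
  qed
qed (auto intro: finite_PiE)

text \<open>For \<open>k \<le> n\<close>; only the arguments \<open>x 1, \<dots>, x (n - k + 1)\<close> are used.\<close>

definition partial_bell :: "nat \<Rightarrow> nat \<Rightarrow> (nat \<Rightarrow> complex) \<Rightarrow> complex" where
  "partial_bell n k x =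
     (\<Sum>e \<in> bell_indices n k.
        fact n / (\<Prod>m = 1..n - k + 1. fact (e m)) *
        (\<Prod>m = 1..n - k + 1. (x m / fact m) ^ e m))"

end

theory Submission
  imports Defs "HOL-Computational_Algebra.Formal_Power_Series"
begin

text \<open>
  Both halves of the theorem are governed by one generating function. Taylor's formula for
  $e^{-t(z(1+X))^a}$ about $X=0$ reads
  $e^{-tz^a}\,\sum_k \frac{(-tz^a)^k}{k!}\,\bigl((1+X)^a-1\bigr)^k$, which suggests that the
  coefficient of $(-t)^k z^{ka-n}$ in $P_{n,t,a}$ is
  \[ c_{n,k} = \frac{n!}{k!}\,[X^n]\,\bigl((1+X)^a-1\bigr)^k, \]
  called \<open>binomial_bell\<close> below. The proof identifies this number with both \<open>b_array\<close> and
  \<open>partial_bell\<close> and with the coefficients of the derivatives.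

  The series $f = (1+X)^a-1$ satisfies $(1+X)f' = a(f+1)$, hence
  $(1+X)(f^k)' = ak(f^k+f^{k-1})$; comparing coefficients gives
  $c_{n+1,k} = (ak-n)\,c_{n,k} + a\,c_{n,k-1}$ (\<open>binomial_bell_rec\<close>). This is the recurrence of
  the array, now with the row $n = 0$ and the column $k = 0$ included, so the array equals
  $c_{n,k}$ on its triangle (\<open>b_array_eq_binomial_bell\<close>).

  Differentiating $t^j z^{ja-n} e^{-tz^a}$ produces the factor $ja-n$ at the same $j$ and a
  factor $-ta$ at $j+1$, so the derivatives obey the same recurrence, starting from
  $c_{0,0}=1$ (\<open>higher_deriv_exp_powr\<close>). Since the exponential never vanishes, it can be
  cancelled to obtain $P_{n,t,a}$.

  Finally, expanding $\bigl(\sum_m x_m X^m/m!\bigr)^k$ by the multinomial theorem shows that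
  $B_{n,k}(x)$ is $n!/k!$ times its $n$-th coefficient (\<open>partial_bell_eq_fps_power_nth\<close>). For
  $x_m = (a)_m$ the series is $f$ by Newton's binomial series, so
  $B_{n,k}((a)_1,(a)_2,\dots) = c_{n,k}$.
\<close>

unbundle no vec_syntax
unbundle fps_syntax

section \<open>The multinomial theorem for formal power series\<close>

lemma finite_weak_compositions:
  assumes "finite S"
  shows "finite {e \<in> S \<rightarrow>\<^sub>E (UNIV :: nat set). sum e S = k}"
proof (rule finite_subset)
  show "{e \<in> S \<rightarrow>\<^sub>E (UNIV :: nat set). sum e S = k} \<subseteq> S \<rightarrow>\<^sub>E {..k}"
    using assms by (auto simp: PiE_iff extensional_def intro: member_le_sum)
qed (use assms in \<open>auto intro: finite_PiE\<close>)

text \<open>Induction on the index set: a power of \<open>y x + (\<Sum>m\<in>S. y m)\<close> is split by the binomial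
  theorem, and the exponent of \<open>y x\<close> together with an exponent tuple on \<open>S\<close> is the same
  thing as an exponent tuple on \<open>insert x S\<close>.\<close>

lemma fps_multinomial:
  fixes y :: "'i \<Rightarrow> 'a :: field_char_0 fps"
  assumes "finite S"
  shows "(\<Sum>m\<in>S. y m) ^ k =
    (\<Sum>e \<in> {e \<in> S \<rightarrow>\<^sub>E UNIV. sum e S = k}.
       fps_const (fact k / (\<Prod>m\<in>S. fact (e m))) * (\<Prod>m\<in>S. y m ^ e m))"
  using assms
proof (induction S arbitrary: k rule: finite_induct)
  case empty
  \<comment> \<open>The only exponent tuple on the empty index set is the one that is undefined everywhere.\<close>
  have "{e \<in> {} \<rightarrow>\<^sub>E (UNIV :: nat set). sum e ({} :: 'i set) = k}
      = (if k = 0 then {\<lambda>_. undefined} else {})"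
    by auto
  then show ?case
    by (simp add: power_0_left)
next
  case (insert x S)
  define C where "C = (\<lambda>S k. {e \<in> S \<rightarrow>\<^sub>E (UNIV :: nat set). sum e (S :: 'i set) = k})"
  define summand where "summand = (\<lambda>S k e. fps_const (fact k / (\<Prod>m\<in>S. fact (e m)))
                                * (\<Prod>m\<in>S. y m ^ e m))"
  note [simp] = insert.hyps
  have IH: "(\<Sum>m\<in>S. y m) ^ j = sum (summand S j) (C S j)" for j
    using insert.IH by (simp add: C_def summand_def)
  have fin: "finite (C S j)" for j
    unfolding C_def by (rule finite_weak_compositions) simp
  have off: "(\<Prod>m\<in>S. h m ((g(x := i)) m)) = (\<Prod>m\<in>S. h m (g m))"
    for h :: "'i \<Rightarrow> nat \<Rightarrow> 'c :: comm_monoid_mult" and g i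
    using insert.hyps by (intro prod.cong) auto
  have off_sum: "(\<Sum>m\<in>S. (g(x := i)) m) = (\<Sum>m\<in>S. g m :: nat)" for g i
    using insert.hyps by (intro sum.cong) auto
  have split_summand: "of_nat (k choose i) * y x ^ i * summand S (k - i) g = summand (insert x S) k (g(x := i))"
    if "i \<le> k" for i g
  proof -
    have "of_nat (k choose i) * y x ^ i * summand S (k - i) g =
        (fps_const (of_nat (k choose i)) * fps_const (fact (k - i) / (\<Prod>m\<in>S. fact (g m))))
        * (y x ^ i * (\<Prod>m\<in>S. y m ^ g m))"
      by (simp only: summand_def fps_of_nat mult_ac)
    also have "of_nat (k choose i) * (fact (k - i) / (\<Prod>m\<in>S. fact (g m)))
        = (fact k / (fact i * (\<Prod>m\<in>S. fact (g m))) :: 'a)"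
      using that by (simp add: binomial_fact)
    then have "fps_const (of_nat (k choose i)) * fps_const (fact (k - i) / (\<Prod>m\<in>S. fact (g m)))
        = fps_const (fact k / (fact i * (\<Prod>m\<in>S. fact (g m))) :: 'a)"
      by simp
    finally show ?thesis
      using off[of "\<lambda>_ v. fact v :: 'a" g i] off[of "\<lambda>m v. y m ^ v" g i]
      by (simp add: summand_def mult.assoc)
  qed
  have "(\<Sum>m\<in>insert x S. y m) ^ k
      = (\<Sum>i\<le>k. of_nat (k choose i) * y x ^ i * (\<Sum>m\<in>S. y m) ^ (k - i))"
    by (simp add: binomial_ring)
  also have "\<dots> = (\<Sum>i\<le>k. \<Sum>g \<in> C S (k - i). summand (insert x S) k (g(x := i)))"
    by (simp add: IH sum_distrib_left split_summand)
  also have "\<dots> = (\<Sum>(i, g) \<in> (SIGMA i:{..k}. C S (k - i)). summand (insert x S) k (g(x := i)))"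
    by (intro sum.Sigma) (auto simp: fin)
  also have "\<dots> = sum (summand (insert x S) k) (C (insert x S) k)"
  proof (rule sum.reindex_bij_witness[where
        i = "\<lambda>e. (e x, e(x := undefined))" and j = "\<lambda>(i, g). g(x := i)"], goal_cases)
    case (1 p)
    then show ?case
      using insert.hyps by (auto simp: C_def PiE_iff extensional_def fun_eq_iff)
  next
    case (2 p)
    then show ?case
      using insert.hyps
      by (auto simp: C_def PiE_iff extensional_def off_sum[unfolded fun_upd_def])
  next
    case (3 e)
    then show ?case by auto
  next
    case (4 e)
    then show ?case
      using insert.hyps
      by (auto simp: C_def PiE_iff extensional_def off_sum[unfolded fun_upd_def])
  next
    case (5 p)
    then show ?case by auto
  qed
  finally show ?case by (simp only: C_def summand_def)
qed

section \<open>Partial Bell polynomials as coefficients of powers\<close>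

text \<open>A contribution to the \<open>n\<close>-th coefficient picks one term from each of the \<open>k\<close> factors; as
  these terms all have degree at least 1, none has degree above \<open>n - k + 1\<close>. This
  is why the Bell polynomial needs only \<open>n - k + 1\<close> arguments.\<close>

lemma fps_power_nth_cong_initial:
  fixes f g :: "'a :: comm_semiring_1 fps"
  assumes "f $ 0 = 0" "g $ 0 = 0" and agree: "\<And>i. i \<le> N \<Longrightarrow> f $ i = g $ i"
    and "n + 1 \<le> N + k"
  shows "(f ^ k) $ n = (g ^ k) $ n"
  using assms(4)
proof (induction k arbitrary: n)
  case 0
  then show ?case by simp
next
  case (Suc k)
  have "f $ i * (f ^ k) $ (n - i) = g $ i * (g ^ k) $ (n - i)" if "i \<le> n" for i
  proof (cases "i = 0 \<or> n - i < k")
    case True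
    then show ?thesis
      using assms(1,2) startsby_zero_power_prefix[of f k] startsby_zero_power_prefix[of g k] by auto
  next
    case False
    then show ?thesis
      using Suc.prems that agree[of i] Suc.IH[of "n - i"] by auto
  qed
  then show ?case
    by (simp add: fps_mult_nth)
qed

text \<open>The series may be cut off after degree \<open>n - k + 1\<close> without changing the coefficient. Each
  multinomial summand of the resulting polynomial's power is then a monomial of degree
  \<open>\<Sum>m. m * e m\<close>, so that extracting the \<open>n\<close>-th coefficient imposes exactly the second
  condition on the exponent tuples in a Bell polynomial.\<close>

lemma partial_bell_eq_fps_power_nth:
  assumes "f $ 0 = 0" and coeff: "\<And>m. 1 \<le> m \<Longrightarrow> f $ m = x m / fact m"
  shows "partial_bell n k x = fact n / fact k * (f ^ k) $ n"
proof -
  define N where "N = n - k + 1"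
  define c where "c = (\<lambda>m. x m / fact m)"
  define p where "p = (\<Sum>m = 1..N. fps_const (c m) * fps_X ^ m)"
  define w where "w = (\<lambda>e :: nat \<Rightarrow> nat. fact k / (\<Prod>m = 1..N. fact (e m)) * (\<Prod>m = 1..N. c m ^ e m))"
  have p_nth: "p $ i = (if 1 \<le> i \<and> i \<le> N then c i else 0)" for i
    by (auto simp: p_def fps_sum_nth if_distrib cong: if_cong)
  have monomial: "fps_const (fact k / (\<Prod>m = 1..N. fact (e m)))
        * (\<Prod>m = 1..N. (fps_const (c m) * fps_X ^ m) ^ e m)
      = fps_const (w e) * fps_X ^ (\<Sum>m = 1..N. m * e m)" for e :: "nat \<Rightarrow> nat"
  proof -
    have "(\<Prod>m = 1..N. (fps_const (c m) * fps_X ^ m) ^ e m)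
        = (\<Prod>m = 1..N. fps_const (c m ^ e m)) * (\<Prod>m = 1..N. fps_X ^ (m * e m))"
      by (simp add: power_mult_distrib prod.distrib power_mult)
    also have "(\<Prod>m = 1..N. fps_const (c m ^ e m)) = fps_const (\<Prod>m = 1..N. c m ^ e m)"
      by (induction N) simp_all
    finally show ?thesis
      by (simp add: w_def power_sum flip: mult.assoc)
  qed
  let ?E = "{e \<in> {1..N} \<rightarrow>\<^sub>E (UNIV :: nat set). sum e {1..N} = k}"
  have "(f ^ k) $ n = (p ^ k) $ n"
    by (rule fps_power_nth_cong_initial[where N = N])
       (auto simp: assms p_nth c_def N_def Suc_le_eq)
  also have "p ^ k = (\<Sum>e\<in>?E. fps_const (w e) * fps_X ^ (\<Sum>m = 1..N. m * e m))"
    unfolding p_def by (subst fps_multinomial) (simp_all only: monomial finite_atLeastAtMost)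
  also have "\<dots> $ n = (\<Sum>e\<in>?E. if (\<Sum>m = 1..N. m * e m) = n then w e else 0)"
    by (auto simp: fps_sum_nth intro!: sum.cong)
  also have "\<dots> = sum w {e \<in> ?E. (\<Sum>m = 1..N. m * e m) = n}"
    by (rule sum.inter_filter[symmetric]) (rule finite_weak_compositions, simp)
  also have "{e \<in> ?E. (\<Sum>m = 1..N. m * e m) = n} = bell_indices n k"
    by (auto simp: bell_indices_def N_def)
  finally show ?thesis
    by (simp add: partial_bell_def w_def c_def N_def sum_distrib_left)
qed

section \<open>The array as a family of binomial series coefficients\<close>

definition binomial_bell :: "'a :: field_char_0 \<Rightarrow> nat \<Rightarrow> nat \<Rightarrow> 'a" where
  "binomial_bell a k n = fact n / fact k * ((fps_binomial a - 1) ^ k) $ n"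

lemma binomial_bell_0_right: "binomial_bell a k 0 = (if k = 0 then 1 else 0)"
  by (simp add: binomial_bell_def)

lemma binomial_bell_0_left: "binomial_bell a 0 n = (if n = 0 then 1 else 0)"
  by (simp add: binomial_bell_def)

lemma binomial_bell_eq_0: "n < k \<Longrightarrow> binomial_bell a k n = 0"
  using startsby_zero_power_prefix[of "fps_binomial a - 1" k]
  by (simp add: binomial_bell_def)

text \<open>The series \<open>f = (1 + X)^a - 1\<close> solves \<open>(1 + X) f' = a (f + 1)\<close>, so its powers solve
  \<open>(1 + X) (f ^ Suc k)' = a (k + 1) (f ^ Suc k + f ^ k)\<close>; the recurrence compares the
  coefficients of \<open>X ^ n\<close>.\<close>

lemma binomial_bell_rec:
  "binomial_bell a (Suc k) (Suc n)
     = (a * of_nat (Suc k) - of_nat n) * binomial_bell a (Suc k) n + a * binomial_bell a k n"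
proof -
  define f where "f = fps_binomial a - 1"
  have unit: "(1 + fps_X :: 'a fps) $ 0 \<noteq> 0"
    by simp
  have ode: "(1 + fps_X) * fps_deriv f = fps_const a * (f + 1)"
    by (simp add: f_def fps_binomial_deriv fps_divide_unit[OF unit]
        inverse_mult_eq_1'[OF unit] mult.left_commute[of "1 + fps_X"])
  have "(1 + fps_X) * fps_deriv (f ^ Suc k)
      = fps_const (of_nat (Suc k)) * f ^ k * ((1 + fps_X) * fps_deriv f)"
    by (simp only: fps_deriv_power mult_ac diff_Suc_1)
  also have "\<dots> = fps_const (of_nat (Suc k) * a) * (f ^ Suc k + f ^ k)"
    unfolding ode fps_const_mult[symmetric] by (simp only: power_Suc ring_distribs mult_ac mult_1_left mult_1_right)
  finally have "fps_deriv (f ^ Suc k) + fps_X * fps_deriv (f ^ Suc k)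
      = fps_const (of_nat (Suc k) * a) * (f ^ Suc k + f ^ k)"
    by (simp only: distrib_right mult_1_left)
  then have "(fps_deriv (f ^ Suc k) + fps_X * fps_deriv (f ^ Suc k)) $ n
      = (fps_const (of_nat (Suc k) * a) * (f ^ Suc k + f ^ k)) $ n"
    by (rule arg_cong)
  moreover have "(fps_X * fps_deriv g) $ n = of_nat n * g $ n" for g :: "'a fps"
    by (cases n) simp_all
  ultimately have coeff: "of_nat (Suc n) * (f ^ Suc k) $ Suc n
      = (a * of_nat (Suc k) - of_nat n) * (f ^ Suc k) $ n + of_nat (Suc k) * a * (f ^ k) $ n"
    by (simp del: power_Suc of_nat_Suc add: algebra_simps)
  have "binomial_bell a (Suc k) (Suc n)
      = fact n / fact (Suc k) * (of_nat (Suc n) * (f ^ Suc k) $ Suc n)"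
    by (simp only: binomial_bell_def f_def fact_Suc[of n] times_divide_eq_left times_divide_eq_right mult_ac)
  also have "\<dots> = (a * of_nat (Suc k) - of_nat n) * (fact n / fact (Suc k) * (f ^ Suc k) $ n)
      + a * (of_nat (Suc k) * fact n / fact (Suc k) * (f ^ k) $ n)"
    unfolding coeff by (simp only: distrib_left mult_ac times_divide_eq_left times_divide_eq_right)
  also have "of_nat (Suc k) * fact n / fact (Suc k) = (fact n / fact k :: 'a)"
    by (simp del: of_nat_Suc)
  finally show ?thesis
    by (simp only: binomial_bell_def f_def)
qed

text \<open>The prescribed first column and diagonal of the array are the values that the recurrence
  of \<open>binomial_bell\<close> produces: the first column consists of the coefficients of the binomial
  series itself, scaled by \<open>fact n\<close>, and on the diagonal the entry \<open>binomial_bell a (Suc n) n\<close> vanishes.\<close>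

lemma b_array_eq_binomial_bell:
  assumes "1 \<le> j" "j \<le> n"
  shows "b_array a j n = binomial_bell a j n"
  using assms
proof (induction n arbitrary: j)
  case 0
  then show ?case by simp
next
  case (Suc n)
  obtain k where j: "j = Suc k"
    using Suc.prems by (cases j) auto
  consider "k = 0" | "k = n" "0 < k" | "0 < k" "k < n"
    using Suc.prems j by linarith
  then show ?case
  proof cases
    case 1
    then have "b_array a j (Suc n) = fact (Suc n) * (a gchoose Suc n)"
      by (simp add: j falling_fact_def gbinomial_prod_rev lessThan_atLeast0 del: fact_Suc prod.lessThan_Suc prod.op_ivl_Suc)
    with 1 show ?thesis
      by (simp add: j binomial_bell_def del: fact_Suc)
  next
    case 2
    then have "binomial_bell a j (Suc n) = a * binomial_bell a n n"
      using j by (simp add: binomial_bell_rec binomial_bell_eq_0)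
    also have "binomial_bell a n n = a ^ n"
      using 2 Suc.IH[of n] b_array_diag[of n a] by simp
    finally show ?thesis
      using 2 j by simp
  next
    case 3
    then show ?thesis
      using j Suc.IH[of k] Suc.IH[of "Suc k"] by (simp add: binomial_bell_rec)
  qed
qed

section \<open>Derivatives of the exponential of a power\<close>

text \<open>Differentiating \<open>exp (L z) = z\<close> shows that \<open>L\<close> has derivative \<open>1 / z\<close>, written here as
  \<open>exp (- L z)\<close> so that it combines directly with the branch power.\<close>

lemma branch_powr_has_field_derivative:
  assumes "open \<Omega>" "log_branch_on \<Omega> L" "z \<in> \<Omega>"
  shows "((\<lambda>z. branch_powr L z c) has_field_derivative c * branch_powr L z (c - 1)) (at z)"
proof -
  have ev: "exp (L w) = w" if "w \<in> \<Omega>" for w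
    using assms(2) that by (simp add: log_branch_on_def)
  have dL: "(L has_field_derivative deriv L z) (at z)"
    using assms holomorphic_derivI by (auto simp: log_branch_on_def)
  have "((\<lambda>w. exp (L w)) has_field_derivative exp (L z) * deriv L z) (at z)"
    by (rule derivative_eq_intros dL refl)+
  moreover have "((\<lambda>w. exp (L w)) has_field_derivative 1) (at z)"
    by (rule has_field_derivative_transform_within_open[OF DERIV_ident assms(1,3)]) (simp add: ev)
  ultimately have "exp (L z) * deriv L z = 1"
    by (rule DERIV_unique)
  then have "deriv L z = exp (- L z)"
    by (simp add: exp_minus field_simps)
  with dL have "(L has_field_derivative exp (- L z)) (at z)"
    by simp
  then show ?thesis
    unfolding branch_powr_def
    by (auto intro!: derivative_eq_intros simp: algebra_simps exp_diff exp_minus divide_inverse)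
qed

lemma branch_powr_add: "branch_powr L z (c + d) = branch_powr L z c * branch_powr L z d"
  by (simp add: branch_powr_def distrib_right exp_add)

text \<open>Starting at \<open>n = 0\<close>, where the only nonzero coefficient is the one at \<open>j = 0\<close>, makes the
  induction uniform: differentiating the power and differentiating the exponential yield the
  two terms of the recurrence for \<open>binomial_bell\<close>.\<close>

lemma higher_deriv_exp_powr:
  assumes "open \<Omega>" "log_branch_on \<Omega> L" "z \<in> \<Omega>"
  shows "(deriv ^^ n) (exp_powr L t a) z =
    (\<Sum>j\<le>n. (- t) ^ j * binomial_bell a j n * branch_powr L z (of_nat j * a - of_nat n))
    * exp (- t * branch_powr L z a)"
  using assms(3)
proof (induction n arbitrary: z)
  case 0
  then show ?case
    by (simp add: exp_powr_def binomial_bell_0_right branch_powr_def)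
next
  case (Suc n)
  define W where "W = (\<lambda>c. branch_powr L z c)"
  define B where "B = (\<lambda>j. binomial_bell a j n)"
  define Q where "Q = (\<lambda>z. \<Sum>j\<le>n. (- t) ^ j * binomial_bell a j n
                               * branch_powr L z (of_nat j * a - of_nat n))"
  define Q' where "Q' = (\<Sum>j\<le>n. (- t) ^ j * B j
                            * ((of_nat j * a - of_nat n) * W (of_nat j * a - of_nat (Suc n))))"
  note dW = branch_powr_has_field_derivative[OF assms(1,2) Suc.prems]
  have dQ: "(Q has_field_derivative Q') (at z)"
    unfolding Q_def Q'_def B_def W_def
    by (rule derivative_eq_intros dW refl)+ (simp add: algebra_simps)
  have "((\<lambda>z. Q z * exp (- t * branch_powr L z a)) has_field_derivative
      (Q' + (- t) * a * W (a - 1) * Q z) * exp (- t * W a)) (at z)"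
    by (rule derivative_eq_intros dQ dW refl)+ (simp add: W_def algebra_simps)
  then have "((deriv ^^ n) (exp_powr L t a) has_field_derivative
      (Q' + (- t) * a * W (a - 1) * Q z) * exp (- t * W a)) (at z)"
    by (rule has_field_derivative_transform_within_open[OF _ assms(1) Suc.prems])
       (simp add: Suc.IH Q_def)
  then have "(deriv ^^ Suc n) (exp_powr L t a) z
      = (Q' + (- t) * a * W (a - 1) * Q z) * exp (- t * W a)"
    by (simp add: DERIV_imp_deriv)
  also have "Q' + (- t) * a * W (a - 1) * Q z =
      (\<Sum>j\<le>Suc n. (- t) ^ j * binomial_bell a j (Suc n) * W (of_nat j * a - of_nat (Suc n)))"
  proof -
    let ?w = "\<lambda>j. W (of_nat j * a - of_nat (Suc n))"
    have "W (a - 1) * W (of_nat j * a - of_nat n) = ?w (Suc j)" for j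
      by (simp add: W_def algebra_simps flip: branch_powr_add)
    then have "(- t) * a * W (a - 1) * Q z = (\<Sum>j\<le>n. (- t) ^ Suc j * (a * B j) * ?w (Suc j))"
      unfolding Q_def sum_distrib_left
      by (intro sum.cong refl) (simp add: B_def W_def mult_ac)
    moreover have "Q' = (\<Sum>j\<le>n. (- t) ^ j * ((of_nat j * a - of_nat n) * B j) * ?w j)"
      unfolding Q'_def by (intro sum.cong refl) (simp only: mult_ac)
    \<comment> \<open>Adding the vanishing term at \<open>Suc n\<close> and removing the one at \<open>0\<close>, where either the
      factor \<open>0 * a - n\<close> or \<open>binomial_bell a 0 n\<close> is zero, aligns this sum with the other.\<close>
    moreover have "\<dots> = (\<Sum>j\<le>Suc n. (- t) ^ j * ((of_nat j * a - of_nat n) * B j) * ?w j)"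
      by (simp add: B_def binomial_bell_eq_0)
    moreover have "\<dots> = (\<Sum>j\<le>n. (- t) ^ Suc j * ((of_nat (Suc j) * a - of_nat n) * B (Suc j)) * ?w (Suc j))"
      by (subst sum.atMost_Suc_shift) (simp add: B_def binomial_bell_0_left)
    ultimately have "Q' + (- t) * a * W (a - 1) * Q z =
        (\<Sum>j\<le>n. (- t) ^ Suc j * binomial_bell a (Suc j) (Suc n) * ?w (Suc j))"
      by (simp only: sum.distrib[symmetric] binomial_bell_rec B_def)
         (intro sum.cong refl, simp add: algebra_simps)
    also have "\<dots> = (\<Sum>j\<le>Suc n. (- t) ^ j * binomial_bell a j (Suc n) * ?w j)"
      by (simp add: sum.atMost_Suc_shift binomial_bell_0_left del: sum.atMost_Suc)
    finally show ?thesis .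
  qed
  finally show ?case
    by (simp add: W_def)
qed

theorem theorem3p1:
  fixes \<Omega> :: "complex set" and L :: "complex \<Rightarrow> complex" and a t :: complex
    and P :: "nat \<Rightarrow> complex \<Rightarrow> complex"
  assumes "open \<Omega>" and "\<Omega> \<noteq> {}" and "simply_connected \<Omega>" and "\<Omega> \<subseteq> - {0}"
    and "log_branch_on \<Omega> L"
    and P: "\<And>n z. z \<in> \<Omega> \<Longrightarrow>
      (deriv ^^ n) (exp_powr L t a) z = P n z * exp (- t * branch_powr L z a)"
  shows "(\<forall>n\<ge>1. \<forall>z\<in>\<Omega>.
            P n z = (\<Sum>j = 1..n. (-1) ^ j * b_array a j n * t ^ j
                       * branch_powr L z (of_nat j * a - of_nat n)))
       \<and> (\<forall>n j. 1 \<le> j \<and> j \<le> n \<longrightarrow> b_array a j n = partial_bell n j (falling_fact a))"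
proof (intro conjI allI impI ballI)
  fix n :: nat and z assume n: "1 \<le> n" and z: "z \<in> \<Omega>"
  have "P n z = (\<Sum>j\<le>n. (- t) ^ j * binomial_bell a j n
                   * branch_powr L z (of_nat j * a - of_nat n))"
    using P[OF z, of n] higher_deriv_exp_powr[OF assms(1,5) z, of n t a] by simp
  also have "\<dots> = (\<Sum>j = 1..n. (- t) ^ j * binomial_bell a j n
                   * branch_powr L z (of_nat j * a - of_nat n))"
    using n by (intro sum.mono_neutral_right) (auto simp: binomial_bell_0_left not_le)
  also have "\<dots> = (\<Sum>j = 1..n. (-1) ^ j * b_array a j n * t ^ j
                   * branch_powr L z (of_nat j * a - of_nat n))"
    by (intro sum.cong refl) (simp add: b_array_eq_binomial_bell power_minus[of t])
  finally show "P n z = \<dots>" .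
next
  fix n j :: nat assume nj: "1 \<le> j \<and> j \<le> n"
  have "partial_bell n j (falling_fact a) = binomial_bell a j n"
    unfolding binomial_bell_def
    by (rule partial_bell_eq_fps_power_nth)
       (auto simp: falling_fact_def gbinomial_prod_rev lessThan_atLeast0)
  with nj show "b_array a j n = partial_bell n j (falling_fact a)"
    by (simp add: b_array_eq_binomial_bell)
qed

end
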